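(* Let $R$ be a supertropical domain and $n\ge1$. Vectors $v_1,\dots,v_n\in R^{(n)}$ are tropically dependent if and only if $|A|\in\mathcal G_0$, where $A$ is the $n\times n$ matrix whose rows are $v_1,\dots,v_n$.
   Context: A supertropical semiring $(R,\mathcal G_0,\nu)$ is a commutative semiring $R$ with unit $\mathbb 1$ and zero $\mathbb 0$ (with $\mathbb 0 r=\mathbb 0$ for all $r$), a semiring ideal $\mathcal G_0=\mathcal G\cup\{\mathbb 0\}$ (the ghost ideal, where $\mathcal G=\mathcal G_0\setminus\{\mathbb 0\}$), and an idempotent map $\nu:R\to\mathcal G_0$, written $a^\nu=\nu(a)$, preserving addition and multiplication, given by $\nu(a)=a+a$ and equal to the identity on $\mathcal G_0$, such that $a+b=a^\nu$ if $a^\nu=b^\nu$, and $a+b\in\{a,b\}$ if $a^\nu\ne b^\nu$. $\mathcal G_0$ is totally ordered by $a^\nu\le b^\nu$ iff $a^\nu+b^\nu=b^\nu$. Tangible elements: $\mathcal T=R\setminus\mathcal G_0$; $\mathcal T_0=\mathcal T\cup\{\mathbb 0\}$. It is a supertropical domain if $\mathcal T$ is a multiplicative monoid (closed under multiplication, containing $\mathbb 1$) and $\nu|_{\mathcal T}:\mathcal T\to\mathcal G$ is onto. Tropical determinant: $|A|=\sum_{\pi\in S_n}a_{1,\pi(1)}\cdots a_{n,\pi(n)}$. $R^{(n)}$ is the free module of $n$-tuples. Vectors $v_1,\dots,v_m\in R^{(n)}$ (as an indexed family) are tropically dependent if there are $\alpha_1,\dots,\alpha_m\in\mathcal T_0$,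 not all $\mathbb 0$, such that every component of $\sum_i\alpha_iv_i$ lies in $\mathcal G_0$. *)

theory Defs
  imports "HOL-Analysis.Determinants"
begin

text \<open>
  The semiring \<open>R\<close> is the whole type \<open>'a\<close>. The axiom \<open>0 \<noteq> 1\<close> of class \<^class>\<open>comm_semiring_1\<close>
  is no restriction for supertropical domains, where \<open>1\<close> is tangible and \<open>0\<close> is not.
\<close>

locale supertropical_semiring =
  fixes G0 :: "'a::comm_semiring_1 set"
    and nu :: "'a \<Rightarrow> 'a"
  assumes zero_in_G0: "0 \<in> G0"
    and add_in_G0: "\<lbrakk>a \<in> G0; b \<in> G0\<rbrakk> \<Longrightarrow> a + b \<in> G0"
    and mult_in_G0: "a \<in> G0 \<Longrightarrow> r * a \<in> G0"
    and nu_in_G0: "nu a \<in> G0"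
    and nu_idem: "nu (nu a) = nu a"
    and nu_add: "nu (a + b) = nu a + nu b"
    and nu_mult: "nu (a * b) = nu a * nu b"
    and nu_eq_double: "nu a = a + a"
    and nu_ghost: "a \<in> G0 \<Longrightarrow> nu a = a"
    and add_nu_eq: "nu a = nu b \<Longrightarrow> a + b = nu a"
    and add_nu_neq: "nu a \<noteq> nu b \<Longrightarrow> a + b \<in> {a, b}"
begin

text \<open>The total order on the ghost ideal is a consequence of the other axioms.\<close>

lemma linear_order_ghost: "linear_order_on G0 {(a, b). a \<in> G0 \<and> b \<in> G0 \<and> a + b = b}"
  unfolding linear_order_on_def partial_order_on_def preorder_on_def
proof (intro conjI)
  show "{(a, b). a \<in> G0 \<and> b \<in> G0 \<and> a + b = b} \<subseteq> G0 \<times> G0"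
    by auto
  show "refl_on G0 {(a, b). a \<in> G0 \<and> b \<in> G0 \<and> a + b = b}"
    by (auto simp: refl_on_def nu_ghost simp flip: nu_eq_double)
  show "trans {(a, b). a \<in> G0 \<and> b \<in> G0 \<and> a + b = b}"
    by (auto simp: trans_def) (metis add.assoc)
  show "antisym {(a, b). a \<in> G0 \<and> b \<in> G0 \<and> a + b = b}"
    by (auto simp: antisym_def add.commute)
  show "total_on G0 {(a, b). a \<in> G0 \<and> b \<in> G0 \<and> a + b = b}"
    unfolding total_on_def
  proof (intro ballI impI)
    fix a b assume "a \<in> G0" "b \<in> G0" "a \<noteq> b"
    then have "a + b = a \<or> a + b = b"
      using add_nu_neq[of a b] by (simp add: nu_ghost)
    then show "(a, b) \<in> {(a, b). a \<in> G0 \<and> b \<in> G0 \<and> a + b = b} \<or>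
               (b, a) \<in> {(a, b). a \<in> G0 \<and> b \<in> G0 \<and> a + b = b}"
      using \<open>a \<in> G0\<close> \<open>b \<in> G0\<close> by (auto simp: add.commute)
  qed
qed

end

definition tangible :: "'a set \<Rightarrow> 'a set"
  where "tangible G0 = UNIV - G0"

definition tangible0 :: "'a::zero set \<Rightarrow> 'a set"
  where "tangible0 G0 = tangible G0 \<union> {0}"

locale supertropical_domain = supertropical_semiring G0 nu
  for G0 :: "'a::comm_semiring_1 set" and nu :: "'a \<Rightarrow> 'a" +
  assumes one_tangible: "1 \<in> tangible G0"
    and mult_tangible: "\<lbrakk>a \<in> tangible G0; b \<in> tangible G0\<rbrakk> \<Longrightarrow> a * b \<in> tangible G0"
    and nu_tangible_onto: "nu ` tangible G0 = G0 - {0}"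

definition tropical_det :: "'a::comm_semiring_1 ^ 'n ^ 'n \<Rightarrow> 'a"
  where "tropical_det A = (\<Sum>p | p permutes (UNIV :: 'n set). \<Prod>i\<in>UNIV. A $ i $ p i)"

definition tropically_dependent ::
    "'a::comm_semiring_1 set \<Rightarrow> ('m::finite \<Rightarrow> 'a ^ 'n) \<Rightarrow> bool"
  where "tropically_dependent G0 v \<longleftrightarrow>
    (\<exists>\<alpha>. (\<forall>i. \<alpha> i \<in> tangible0 G0) \<and> (\<exists>i. \<alpha> i \<noteq> 0) \<and>
         (\<forall>j. (\<Sum>i\<in>UNIV. \<alpha> i *s v i) $ j \<in> G0))"

end

theory Submission
  imports Defs
begin

text \<open>
  Compare elements by their ghost values: \<open>a \<preceq> b\<close> iff \<open>nu a \<le> nu b\<close>. A finite sum fails to be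
  ghost exactly when one of its summands is tangible and strictly dominates all the others
  (\<open>sum_tangible_iff\<close>), so both sides of the theorem are statements about dominant terms.
  Multiplication by a nonzero element can be cancelled from \<open>\<preceq>\<close> (\<open>nu_le_mult_cancel\<close>). This
  comes from distributivity: if multiplication by a tangible element made a strict inequality an
  equality, a product of tangible elements would be a ghost.

  Suppose the rows are dependent with coefficients \<open>\<alpha>\<close>, but the determinant is tangible. Then one
  permutation \<open>\<sigma>\<close>, taken from columns to rows, is strictly optimal and uses tangible entries only.
  In a column \<open>j\<close> with \<open>\<alpha> (\<sigma> j) \<noteq> 0\<close> the tangible term of row \<open>\<sigma> j\<close> cannot strictly
  dominate, so another row has a term at least as large. Following these rows from column to column
  must close a cycle; rerouting \<open>\<sigma>\<close> along it and cancelling the coefficients gives a different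
  permutation whose weight is at least that of \<open>\<sigma>\<close> (\<open>rerouted_permutation\<close>), a contradiction.

  Conversely, the coefficients come from Cramer's rule. Fix a proper set \<open>J\<close> of columns and let
  \<open>\<alpha> i\<close> be a tangible lift of the largest weight of an injection from \<open>J\<close> to the rows other than
  \<open>i\<close>. In a column \<open>j \<in> J\<close> another row always has a term at least as large as a
  given nonzero term of row \<open>i\<close>: in an optimal injection that avoids \<open>i\<close>, exchange the roles of
  \<open>i\<close> and of the row used by \<open>j\<close> (\<open>dependent_of_partial_matching\<close>). So only columns outside \<open>J\<close> matter, and \<open>J\<close> is chosen for
  them. If the determinant is \<open>0\<close>, take for \<open>J\<close> a largest set of columns that carries an injection
  of nonzero weight; the terms outside \<open>J\<close> are then all \<open>0\<close>. If it is a nonzero ghost, leave out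
  a single column \<open>k\<close>, in which either an optimal permutation meets a ghost entry or two optimal
  permutations differ; column \<open>k\<close> then has a ghost dominant term or two dominant terms.
\<close>

section \<open>The preorder by ghost value\<close>

context supertropical_semiring
begin

definition nu_le :: "'a \<Rightarrow> 'a \<Rightarrow> bool"  (infix "\<preceq>" 50)
  where "a \<preceq> b \<longleftrightarrow> nu a + nu b = nu b"

lemma nu_zero: "nu 0 = 0"
  by (simp add: nu_ghost zero_in_G0)

lemma nu_eq_0_iff: "nu a = 0 \<longleftrightarrow> a = 0"
  using add_nu_eq[of a 0] by (auto simp: nu_zero)

lemma nu_le_of_nu_eq: "nu a = nu b \<Longrightarrow> a \<preceq> b"
  unfolding nu_le_def by (metis nu_eq_double nu_idem)

lemma nu_le_refl: "a \<preceq> a"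
  by (rule nu_le_of_nu_eq) simp

lemma nu_le_trans: "a \<preceq> b \<Longrightarrow> b \<preceq> c \<Longrightarrow> a \<preceq> c"
  unfolding nu_le_def by (metis add.assoc)

lemma nu_le_antisym: "a \<preceq> b \<Longrightarrow> b \<preceq> a \<Longrightarrow> nu a = nu b"
  unfolding nu_le_def by (metis add.commute)

lemma nu_le_total: "a \<preceq> b \<or> b \<preceq> a"
proof (cases "nu a = nu b")
  case False
  then have "nu a + nu b = nu a \<or> nu a + nu b = nu b"
    using add_nu_neq[of "nu a" "nu b"] by (simp add: nu_idem)
  then show ?thesis
    unfolding nu_le_def by (auto simp: add.commute)
qed (simp add: nu_le_of_nu_eq)

lemma zero_nu_le: "0 \<preceq> a"
  by (simp add: nu_le_def nu_zero)

lemma nu_le_zero: "a \<preceq> 0 \<Longrightarrow> a = 0"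
  by (simp add: nu_le_def nu_zero nu_eq_0_iff)

lemma nu_le_mult_left: "a \<preceq> b \<Longrightarrow> c * a \<preceq> c * b"
  unfolding nu_le_def by (metis nu_mult distrib_left)

lemma nu_le_mult: "a \<preceq> b \<Longrightarrow> c \<preceq> d \<Longrightarrow> a * c \<preceq> b * d"
  by (metis nu_le_mult_left nu_le_trans mult.commute)

lemma nu_le_prod: "(\<And>i. i \<in> S \<Longrightarrow> f i \<preceq> g i) \<Longrightarrow> prod f S \<preceq> prod g S"
  by (induction S rule: infinite_finite_induct) (auto intro: nu_le_refl nu_le_mult)

lemma add_eq_dominant:
  assumes "\<not> a \<preceq> b"
  shows "a + b = a"
proof -
  have "nu a \<noteq> nu b"
    using assms nu_le_of_nu_eq by blast
  then have "a + b = a \<or> a + b = b"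
    using add_nu_neq by auto
  moreover have "a + b \<noteq> b"
    using assms nu_add[of a b] by (auto simp: nu_le_def)
  ultimately show ?thesis by blast
qed

lemma nu_le_add: "a \<preceq> a + b"
  unfolding nu_le_def by (metis add.assoc nu_add nu_eq_double nu_idem)

lemma nu_le_sum:
  assumes "finite S" "i \<in> S"
  shows "x i \<preceq> sum x S"
  using assms by (simp add: sum.remove[of S i] nu_le_add)

lemma dominates_add:
  assumes "\<not> c \<preceq> a" "\<not> c \<preceq> b"
  shows "\<not> c \<preceq> a + b"
proof
  assume c: "c \<preceq> a + b"
  have "nu (a + b) = nu a \<or> nu (a + b) = nu b"
  proof (cases "nu a = nu b")
    case True
    then show ?thesis by (simp add: add_nu_eq nu_idem)
  next
    case False
    then show ?thesis using add_nu_neq[of a b] by auto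
  qed
  then show False
    using c assms by (auto simp: nu_le_def)
qed

lemma dominates_sum:
  assumes "c \<noteq> 0" "\<And>i. i \<in> S \<Longrightarrow> \<not> c \<preceq> x i"
  shows "\<not> c \<preceq> sum x S"
  using assms(2)
proof (induction S rule: infinite_finite_induct)
  case (insert i S)
  then show ?case by (simp add: dominates_add)
qed (use assms(1) nu_le_zero in auto)

text \<open>
  Two summands of equal ghost value already add up to a ghost, and a larger summand
  absorbs a smaller one; a tangible sum can therefore only be an unchallenged tangible summand.
\<close>

lemma sum_tangible_iff:
  assumes "finite S"
  shows "sum x S \<notin> G0 \<longleftrightarrow> (\<exists>i\<in>S. x i \<notin> G0 \<and> (\<forall>k\<in>S - {i}. \<not> x i \<preceq> x k))"
proof
  assume "sum x S \<notin> G0"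
  with assms show "\<exists>i\<in>S. x i \<notin> G0 \<and> (\<forall>k\<in>S - {i}. \<not> x i \<preceq> x k)"
  proof (induction S)
    case empty
    then show ?case by (simp add: zero_in_G0)
  next
    case (insert a S)
    let ?s = "sum x S"
    have sum: "x a + ?s \<notin> G0"
      using insert by simp
    have "nu (x a) \<noteq> nu ?s"
      using sum add_nu_eq[of "x a" ?s] nu_in_G0[of "x a"] by auto
    then consider "\<not> x a \<preceq> ?s" | "\<not> ?s \<preceq> x a"
      using nu_le_antisym[of "x a" ?s] by blast
    then show ?case
    proof cases
      case 1
      then have "x a \<notin> G0"
        using sum add_eq_dominant[OF 1] by simp
      moreover have "\<not> x a \<preceq> x k" if "k \<in> S" for k
        using 1 nu_le_sum[OF insert.hyps(1) that, of x] nu_le_trans[of "x a" "x k" ?s] by blast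
      ultimately show ?thesis by auto
    next
      case 2
      then have "?s \<notin> G0"
        using sum add_eq_dominant[OF 2] by (simp add: add.commute)
      then obtain i where i: "i \<in> S" "x i \<notin> G0" "\<forall>k\<in>S - {i}. \<not> x i \<preceq> x k"
        using insert.IH by blast
      have "?s = x i"
      proof -
        have "x i \<noteq> 0"
          using i(2) zero_in_G0 by auto
        then have "\<not> x i \<preceq> sum x (S - {i})"
          using i(3) by (intro dominates_sum) auto
        then show ?thesis
          using i(1) insert.hyps(1) by (simp add: sum.remove[of S i] add_eq_dominant)
      qed
      then show ?thesis
        using 2 i by auto
    qed
  qed
next
  assume "\<exists>i\<in>S. x i \<notin> G0 \<and> (\<forall>k\<in>S - {i}. \<not> x i \<preceq> x k)"
  then obtain i where i: "i \<in> S" "x i \<notin> G0" "\<forall>k\<in>S - {i}. \<not> x i \<preceq> x k"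
    by blast
  have "x i \<noteq> 0"
    using i(2) zero_in_G0 by auto
  then have "\<not> x i \<preceq> sum x (S - {i})"
    using i(3) by (intro dominates_sum) auto
  then have "sum x S = x i"
    using i(1) assms by (simp add: sum.remove[of S i] add_eq_dominant)
  then show "sum x S \<notin> G0"
    using i(2) by simp
qed

lemma sum_tangibleE:
  assumes "finite S" "sum x S \<notin> G0"
  obtains i where "i \<in> S" "x i \<notin> G0" "\<And>k. k \<in> S \<Longrightarrow> x i \<preceq> x k \<Longrightarrow> k = i"
  using assms(2) that unfolding sum_tangible_iff[OF assms(1)] by blast

lemma finite_nu_maximum:
  assumes "finite S" "S \<noteq> {}"
  shows "\<exists>m\<in>S. \<forall>s\<in>S. x s \<preceq> x m"
  using assms
proof (induction S rule: finite_ne_induct)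
  case (insert a S)
  then obtain m where m: "m \<in> S" "\<And>s. s \<in> S \<Longrightarrow> x s \<preceq> x m"
    by auto
  show ?case
  proof (cases "x a \<preceq> x m")
    case True
    then show ?thesis
      using m by (intro bexI[of _ m]) auto
  next
    case False
    then have "x m \<preceq> x a"
      using nu_le_total[of "x m" "x a"] by simp
    then have "x s \<preceq> x a" if "s \<in> S" for s
      by (rule nu_le_trans[OF m(2)[OF that]])
    then show ?thesis
      by (intro bexI[of _ a]) (auto simp: nu_le_refl)
  qed
qed (simp add: nu_le_refl)

end

section \<open>Cancellation in supertropical domains\<close>

context supertropical_domain
begin

lemma tangible_lift:
  assumes "c \<noteq> 0"
  obtains t where "t \<in> tangible G0" "nu t = nu c"
proof -
  have "nu c \<in> nu ` tangible G0"
    using assms by (simp add: nu_tangible_onto nu_in_G0 nu_eq_0_iff)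
  then show thesis
    using that by force
qed

lemma tangible0_lift:
  obtains t where "t \<in> tangible0 G0" "nu t = nu c"
proof (cases "c = 0")
  case True
  then show thesis using that[of 0] by (simp add: tangible0_def)
next
  case False
  then show thesis using that tangible_lift by (metis UnI1 tangible0_def)
qed

lemma tangible0_nonzero: "a \<in> tangible0 G0 \<Longrightarrow> a \<noteq> 0 \<Longrightarrow> a \<notin> G0"
  by (auto simp: tangible0_def tangible_def)

lemma mult_not_ghost: "a \<notin> G0 \<Longrightarrow> b \<notin> G0 \<Longrightarrow> a * b \<notin> G0"
  using mult_tangible by (auto simp: tangible_def)

lemma prod_not_ghost: "(\<And>i. i \<in> S \<Longrightarrow> x i \<notin> G0) \<Longrightarrow> prod x S \<notin> G0"
proof (induction S rule: infinite_finite_induct)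
  case (insert i S)
  then show ?case by (simp add: mult_not_ghost)
qed (use one_tangible in \<open>auto simp: tangible_def\<close>)

lemma prod_ghost:
  assumes "finite S" "i \<in> S" "x i \<in> G0"
  shows "prod x S \<in> G0"
  using assms mult_in_G0[of "x i" "prod x (S - {i})"]
  by (simp add: prod.remove[of S i] mult.commute)

text \<open>
  The lift to tangibles turns a product of nonzero elements into a tangible, hence nonzero, element.
\<close>

lemma mult_nonzero:
  fixes a b :: 'a
  assumes "a \<noteq> 0" "b \<noteq> 0"
  shows "a * b \<noteq> 0"
proof
  assume zero: "a * b = 0"
  obtain s where s: "s \<in> tangible G0" "nu s = nu a"
    using assms(1) by (rule tangible_lift)
  obtain t where t: "t \<in> tangible G0" "nu t = nu b"
    using assms(2) by (rule tangible_lift)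
  have "nu (s * t) = 0"
    using s t zero by (metis nu_mult nu_zero)
  then have "s * t = 0"
    by (simp add: nu_eq_0_iff)
  moreover have "s * t \<in> tangible G0"
    using s t mult_tangible by blast
  ultimately show False
    using zero_in_G0 by (auto simp: tangible_def)
qed

lemma prod_nonzero:
  fixes x :: "'b \<Rightarrow> 'a"
  shows "(\<And>i. i \<in> S \<Longrightarrow> x i \<noteq> 0) \<Longrightarrow> prod x S \<noteq> 0"
  by (induction S rule: infinite_finite_induct) (auto simp: mult_nonzero)

text \<open>
  Only ghost values matter, so \<open>c\<close> and \<open>a\<close> may be taken tangible. If \<open>b\<close> were strictly below \<open>a\<close>
  while \<open>c * b\<close> and \<open>c * a\<close> had the same ghost value, then the tangible
  \<open>c * a = c * (a + b) = c * a + c * b\<close> would be a ghost.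
\<close>

lemma nu_le_mult_cancel:
  assumes "c \<noteq> 0" "c * a \<preceq> c * b"
  shows "a \<preceq> b"
proof (rule ccontr)
  assume not_le: "\<not> a \<preceq> b"
  then have "a \<noteq> 0"
    using zero_nu_le by blast
  then obtain s where s: "s \<in> tangible G0" "nu s = nu a"
    by (rule tangible_lift)
  obtain t where t: "t \<in> tangible G0" "nu t = nu c"
    using assms(1) by (rule tangible_lift)
  have "s + b = s"
    using not_le s by (intro add_eq_dominant) (simp add: nu_le_def)
  then have absorb: "t * s + t * b = t * s"
    by (metis distrib_left)
  have "c * b \<preceq> c * a"
    using not_le nu_le_total nu_le_mult_left by blast
  then have "nu (c * a) = nu (c * b)"
    using assms(2) nu_le_antisym by blast
  then have "nu (t * s) = nu (t * b)"
    using s t by (simp add: nu_mult)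
  then have "t * s \<in> G0"
    using absorb add_nu_eq nu_in_G0 by metis
  then show False
    using mult_tangible[OF t(1) s(1)] by (simp add: tangible_def)
qed

lemma tangible0_maximum:
  assumes "finite S"
  shows "\<exists>t\<in>tangible0 G0. (\<forall>s\<in>S. x s \<preceq> t) \<and> (t \<noteq> 0 \<longrightarrow> (\<exists>s\<in>S. nu t = nu (x s)))"
proof (cases "S = {}")
  case True
  then show ?thesis
    by (intro bexI[of _ 0]) (auto simp: tangible0_def)
next
  case False
  then obtain m where m: "m \<in> S" "\<forall>s\<in>S. x s \<preceq> x m"
    using assms finite_nu_maximum by blast
  obtain t where "t \<in> tangible0 G0" "nu t = nu (x m)"
    by (rule tangible0_lift)
  then show ?thesis
    using m by (intro bexI[of _ t]) (auto simp: nu_le_def)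
qed

end

section \<open>Weights of permutations\<close>

lemma tropical_det_by_columns:
  "tropical_det A = (\<Sum>p | p permutes (UNIV :: 'n::finite set). \<Prod>j\<in>UNIV. A $ p j $ j)"
proof -
  have "(\<Prod>i\<in>UNIV. A $ i $ inv p i) = (\<Prod>j\<in>UNIV. A $ p j $ j)"
    if "p permutes (UNIV :: 'n set)" for p
  proof -
    have "(\<Prod>i\<in>UNIV. A $ i $ inv p i) = (\<Prod>j\<in>UNIV. A $ p j $ inv p (p j))"
      using prod.permute[OF that, of "\<lambda>i. A $ i $ inv p i"] by (simp add: o_def)
    then show ?thesis
      using permutes_inverses(2)[OF that] by simp
  qed
  then show ?thesis
    unfolding tropical_det_def by (subst sum_permutations_inverse) simp
qed

lemma permutes_UNIV_iff_inj: "p permutes (UNIV :: 'n::finite set) \<longleftrightarrow> inj p"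
  by (metis bij_betw_def bij_imp_permutes finite_UNIV_inj_surj finite subset_UNIV UNIV_I permutes_inj)

text \<open>
  A smallest nonempty set mapped into itself is mapped onto itself; it is a cycle of \<open>f\<close>.
\<close>

lemma exists_surjectively_mapped_subset:
  assumes "finite S" "S \<noteq> {}" "f ` S \<subseteq> S"
  obtains C where "C \<subseteq> S" "C \<noteq> {}" "f ` C = C"
proof -
  let ?P = "\<lambda>C. C \<subseteq> S \<and> C \<noteq> {} \<and> f ` C \<subseteq> C"
  obtain C where C: "?P C" and min: "\<And>D. ?P D \<Longrightarrow> card C \<le> card D"
    using assms ex_has_least_nat[of ?P S card] by auto
  have "card C \<le> card (f ` C)"
    using C by (intro min) auto
  then have "f ` C = C"
    using C assms(1) by (metis card_seteq finite_subset)
  then show thesis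
    using C that by blast
qed

context supertropical_domain
begin

section \<open>Dependent rows have a ghost determinant\<close>

text \<open>
  In each column \<open>j\<close> with \<open>\<alpha> (\<sigma> j) \<noteq> 0\<close>, the ghost sum supplies a competitor \<open>\<sigma> (h j)\<close> to the row \<open>\<sigma> j\<close>. On a set of
  columns that \<open>h\<close> permutes, switch to the competitors: the rows involved stay the same, so the same
  nonzero coefficients occur before and after the switch and can be cancelled.
\<close>

lemma rerouted_permutation:
  fixes a :: "'n::finite \<Rightarrow> 'n \<Rightarrow> 'a"
  assumes \<sigma>: "inj \<sigma>" and tangible: "\<And>j. a (\<sigma> j) j \<notin> G0"
    and \<alpha>: "\<And>i. \<alpha> i \<in> tangible0 G0" and nonzero: "\<exists>i. \<alpha> i \<noteq> 0"
    and ghost: "\<And>j. (\<Sum>i\<in>UNIV. \<alpha> i * a i j) \<in> G0"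
  shows "\<exists>\<tau>. inj \<tau> \<and> \<tau> \<noteq> \<sigma> \<and> (\<Prod>j\<in>UNIV. a (\<sigma> j) j) \<preceq> (\<Prod>j\<in>UNIV. a (\<tau> j) j)"
proof -
  define S where "S = {j. \<alpha> (\<sigma> j) \<noteq> 0}"
  have bij: "bij \<sigma>"
    using \<sigma> by (simp add: bij_def finite_UNIV_inj_surj)
  have "\<exists>l\<in>S. l \<noteq> j \<and> \<alpha> (\<sigma> j) * a (\<sigma> j) j \<preceq> \<alpha> (\<sigma> l) * a (\<sigma> l) j" if "j \<in> S" for j
  proof -
    have own: "\<alpha> (\<sigma> j) * a (\<sigma> j) j \<notin> G0"
      using that by (intro mult_not_ghost tangible tangible0_nonzero \<alpha>) (simp add: S_def)
    then obtain k where k: "k \<noteq> \<sigma> j" "\<alpha> (\<sigma> j) * a (\<sigma> j) j \<preceq> \<alpha> k * a k j"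
      using ghost[of j] sum_tangible_iff[of UNIV "\<lambda>i. \<alpha> i * a i j"] by auto
    obtain l where l: "k = \<sigma> l"
      using bij by (metis bij_pointE)
    have "\<alpha> k \<noteq> 0"
      using k(2) own nu_le_zero zero_in_G0 by (metis mult_zero_left)
    then show ?thesis
      using k l by (auto simp: S_def)
  qed
  then obtain h where h: "\<And>j. j \<in> S \<Longrightarrow> h j \<in> S"
      "\<And>j. j \<in> S \<Longrightarrow> h j \<noteq> j"
      "\<And>j. j \<in> S \<Longrightarrow> \<alpha> (\<sigma> j) * a (\<sigma> j) j \<preceq> \<alpha> (\<sigma> (h j)) * a (\<sigma> (h j)) j"
    by metis
  have "S \<noteq> {}"
    using nonzero bij by (metis (mono_tags, lifting) S_def bij_pointE empty_iff mem_Collect_eq)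
  then obtain C where C: "C \<subseteq> S" "C \<noteq> {}" "h ` C = C"
    using exists_surjectively_mapped_subset[of S h] h(1) by auto
  define h' where "h' = (\<lambda>j. if j \<in> C then h j else j)"
  have "surj h'"
    using C(3) by (force simp: h'_def image_def)
  then have inj_h': "inj h'"
    by (simp add: finite_UNIV_surj_inj)
  define \<beta> where "\<beta> j = (if j \<in> C then \<alpha> (\<sigma> j) else 1)" for j
  have le: "\<beta> j * a (\<sigma> j) j \<preceq> \<beta> (h' j) * a (\<sigma> (h' j)) j" for j
  proof (cases "j \<in> C")
    case True
    then have "h j \<in> C" using C(3) by blast
    then show ?thesis
      using True C(1) h(3) by (auto simp: \<beta>_def h'_def)
  qed (simp add: \<beta>_def h'_def nu_le_refl)
  have "(\<Prod>j\<in>UNIV. \<beta> (h' j)) = prod \<beta> UNIV"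
    using prod.permute[of h' UNIV \<beta>] inj_h' by (simp add: permutes_UNIV_iff_inj o_def)
  then have "prod \<beta> UNIV * (\<Prod>j\<in>UNIV. a (\<sigma> j) j) \<preceq> prod \<beta> UNIV * (\<Prod>j\<in>UNIV. a (\<sigma> (h' j)) j)"
    using nu_le_prod[of UNIV "\<lambda>j. \<beta> j * a (\<sigma> j) j" "\<lambda>j. \<beta> (h' j) * a (\<sigma> (h' j)) j"] le
    by (simp add: prod.distrib)
  moreover have "prod \<beta> UNIV \<noteq> 0"
    using C(1) by (intro prod_nonzero) (auto simp: \<beta>_def S_def)
  ultimately have "(\<Prod>j\<in>UNIV. a (\<sigma> j) j) \<preceq> (\<Prod>j\<in>UNIV. a ((\<sigma> \<circ> h') j) j)"
    using nu_le_mult_cancel by (simp add: o_def)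
  moreover have "inj (\<sigma> \<circ> h')"
    using \<sigma> inj_h' by (rule inj_compose)
  moreover have "\<sigma> \<circ> h' \<noteq> \<sigma>"
  proof -
    obtain j where "j \<in> C" using C(2) by blast
    then have "h' j \<noteq> j"
      using C(1) h(2) by (auto simp: h'_def)
    then show ?thesis
      using \<sigma> by (metis comp_apply injD)
  qed
  ultimately show ?thesis by blast
qed

lemma det_ghost_if_dependent:
  fixes v :: "'n::finite \<Rightarrow> 'a ^ 'n"
  assumes "tropically_dependent G0 v"
  shows "tropical_det (\<chi> i. v i) \<in> G0"
proof (rule ccontr)
  obtain \<alpha> where \<alpha>: "\<And>i. \<alpha> i \<in> tangible0 G0" "\<exists>i. \<alpha> i \<noteq> 0"
      "\<And>j. (\<Sum>i\<in>UNIV. \<alpha> i * v i $ j) \<in> G0"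
    using assms by (auto simp: tropically_dependent_def)
  assume "tropical_det (\<chi> i. v i) \<notin> G0"
  then have "(\<Sum>p | p permutes UNIV. \<Prod>j\<in>UNIV. v (p j) $ j) \<notin> G0"
    by (simp add: tropical_det_by_columns)
  then obtain \<sigma> where \<sigma>: "inj \<sigma>" "(\<Prod>j\<in>UNIV. v (\<sigma> j) $ j) \<notin> G0"
    and strict: "\<And>\<tau>. inj \<tau> \<Longrightarrow> (\<Prod>j\<in>UNIV. v (\<sigma> j) $ j) \<preceq> (\<Prod>j\<in>UNIV. v (\<tau> j) $ j) \<Longrightarrow> \<tau> = \<sigma>"
    by (rule sum_tangibleE[rotated]) (auto simp: permutes_UNIV_iff_inj)
  have "v (\<sigma> j) $ j \<notin> G0" for j
    using \<sigma>(2) prod_ghost[of UNIV j "\<lambda>j. v (\<sigma> j) $ j"] by auto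
  then show False
    using rerouted_permutation[of \<sigma> "\<lambda>i j. v i $ j" \<alpha>] \<sigma>(1) \<alpha> strict by blast
qed

section \<open>A ghost determinant makes the rows dependent\<close>

text \<open>
  Here \<open>\<alpha> i\<close> plays the role of the minor without row \<open>i\<close> in a Cramer expansion. Only its ghost value
  matters, so injections may be taken as total functions whose values outside \<open>J\<close> are arbitrary.
  The hypothesis \<open>ghost\<close> disposes of the columns outside \<open>J\<close>.
\<close>

lemma dependent_of_partial_matching:
  fixes v :: "'n::finite \<Rightarrow> 'a ^ 'n"
  assumes J: "J \<noteq> UNIV" and g: "inj_on g J" "(\<Prod>j\<in>J. v (g j) $ j) \<noteq> 0"
    and ghost: "\<And>\<alpha> k. k \<notin> J \<Longrightarrow>
      (\<And>f i. inj_on f J \<Longrightarrow> i \<notin> f ` J \<Longrightarrow> (\<Prod>j\<in>J. v (f j) $ j) \<preceq> \<alpha> i) \<Longrightarrow>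
      (\<And>i. \<alpha> i \<noteq> 0 \<Longrightarrow> \<exists>f. inj_on f J \<and> i \<notin> f ` J \<and> nu (\<alpha> i) = nu (\<Prod>j\<in>J. v (f j) $ j)) \<Longrightarrow>
      (\<Sum>i\<in>UNIV. \<alpha> i * v i $ k) \<in> G0"
  shows "tropically_dependent G0 v"
proof -
  let ?w = "\<lambda>f. \<Prod>j\<in>J. v (f j) $ j"
  let ?F = "\<lambda>i. {f. inj_on f J \<and> i \<notin> f ` J}"
  define Q where "Q i t \<longleftrightarrow> t \<in> tangible0 G0 \<and> (\<forall>f\<in>?F i. ?w f \<preceq> t) \<and>
      (t \<noteq> 0 \<longrightarrow> (\<exists>f\<in>?F i. nu t = nu (?w f)))" for i t
  have "\<exists>t. Q i t" for i
    unfolding Q_def using tangible0_maximum[of "?F i" ?w] by (simp only: Bex_def finite simp_thms)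
  then obtain \<alpha> where all: "Q i (\<alpha> i)" for i
    by metis
  have \<alpha>: "\<alpha> i \<in> tangible0 G0" for i
    using all[of i] by (simp only: Q_def)
  have upper: "?w f \<preceq> \<alpha> i" if "inj_on f J" "i \<notin> f ` J" for f i
    using all[of i] that by (simp add: Q_def)
  have attained: "\<exists>f. inj_on f J \<and> i \<notin> f ` J \<and> nu (\<alpha> i) = nu (?w f)" if "\<alpha> i \<noteq> 0" for i
    using all[of i] that by (auto simp: Q_def)
  have "\<exists>i. \<alpha> i \<noteq> 0"
  proof -
    have "card (g ` J) < card (UNIV :: 'n set)"
      using J g(1) by (simp add: card_image psubset_card_mono psubsetI)
    then have "g ` J \<noteq> UNIV"
      by auto
    then obtain i where "i \<notin> g ` J"
      by blast
    then have "\<alpha> i \<noteq> 0"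
      using upper[OF g(1), of i] g(2) nu_le_zero[of "?w g"] by metis
    then show ?thesis ..
  qed
  moreover have "(\<Sum>i\<in>UNIV. \<alpha> i * v i $ k) \<in> G0" for k
  proof (cases "k \<in> J")
    case False
    then show ?thesis
      using upper attained by (rule ghost)
  next
    case True
    show ?thesis
    proof (rule ccontr)
      assume "(\<Sum>i\<in>UNIV. \<alpha> i * v i $ k) \<notin> G0"
      then obtain i where i: "\<alpha> i * v i $ k \<notin> G0"
        and strict: "\<And>l. \<alpha> i * v i $ k \<preceq> \<alpha> l * v l $ k \<Longrightarrow> l = i"
        using sum_tangible_iff[of UNIV "\<lambda>i. \<alpha> i * v i $ k"] by auto
      have "\<alpha> i \<noteq> 0"
        using i zero_in_G0 by auto
      then obtain f where f: "inj_on f J" "i \<notin> f ` J" "nu (\<alpha> i) = nu (?w f)"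
        using attained by blast
      \<comment> \<open>Column \<open>k\<close> may use row \<open>i\<close> instead of \<open>f k\<close>, which frees row \<open>f k\<close>.\<close>
      let ?f' = "f(k := i)"
      have inj: "inj_on ?f' J"
        using f(1,2) by (auto simp: inj_on_def)
      have free: "f k \<notin> ?f' ` J"
        using f(1,2) True by (auto simp: inj_on_def image_iff)
      have rest: "(\<Prod>j\<in>J - {k}. v (?f' j) $ j) = (\<Prod>j\<in>J - {k}. v (f j) $ j)"
        by (rule prod.cong) auto
      have "v i $ k * ?w f = v (f k) $ k * ?w ?f'"
        using True rest by (simp add: prod.remove[of J k] mult.left_commute)
      moreover have "nu (\<alpha> i * v i $ k) = nu (v i $ k * ?w f)"
        using f(3) by (simp add: nu_mult mult.commute)
      ultimately have "\<alpha> i * v i $ k \<preceq> v (f k) $ k * ?w ?f'"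
        by (simp add: nu_le_of_nu_eq)
      also have "v (f k) $ k * ?w ?f' \<preceq> v (f k) $ k * \<alpha> (f k)"
        using upper[OF inj free] by (rule nu_le_mult_left)
      finally (nu_le_trans) have "f k = i"
        by (intro strict) (simp add: mult.commute)
      then show False
        using f(2) True by blast
    qed
  qed
  ultimately show ?thesis
    using \<alpha> by (auto simp: tropically_dependent_def)
qed

text \<open>
  With \<open>J\<close> a largest set of columns carrying an injection of nonzero weight, a nonzero term in a column
  outside \<open>J\<close> would enlarge \<open>J\<close>. The empty set, of weight \<open>1\<close>, makes such a \<open>J\<close> exist.
\<close>

lemma dependent_if_all_weights_zero:
  fixes v :: "'n::finite \<Rightarrow> 'a ^ 'n"
  assumes zero: "\<And>\<sigma>. inj \<sigma> \<Longrightarrow> (\<Prod>j\<in>UNIV. v (\<sigma> j) $ j) = 0"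
  shows "tropically_dependent G0 v"
proof -
  let ?P = "\<lambda>J. \<exists>f. inj_on f J \<and> (\<Prod>j\<in>J. v (f j) $ j) \<noteq> 0"
  have empty: "?P {}" by simp
  have "\<forall>J. ?P J \<longrightarrow> card J < Suc (card (UNIV :: 'n set))"
    by (simp add: card_mono less_Suc_eq_le)
  from ex_has_greatest_nat[of ?P, OF empty this]
  obtain J where J: "?P J \<and> (\<forall>K. ?P K \<longrightarrow> card K \<le> card J)" ..
  then have max: "card K \<le> card J" if "?P K" for K
    using that by simp
  from J obtain g where g: "inj_on g J" "(\<Prod>j\<in>J. v (g j) $ j) \<noteq> 0"
    by auto
  have "J \<noteq> UNIV"
    using g zero by auto
  then show ?thesis
    using g
  proof (rule dependent_of_partial_matching)
    fix \<alpha> k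
    assume k: "k \<notin> J"
      and attained: "\<And>i. \<alpha> i \<noteq> 0 \<Longrightarrow>
        \<exists>f. inj_on f J \<and> i \<notin> f ` J \<and> nu (\<alpha> i) = nu (\<Prod>j\<in>J. v (f j) $ j)"
    have "\<alpha> i * v i $ k = 0" for i
    proof (rule ccontr)
      assume nonzero: "\<alpha> i * v i $ k \<noteq> 0"
      then have "\<alpha> i \<noteq> 0" by auto
      then obtain f where f: "inj_on f J" "i \<notin> f ` J" "nu (\<alpha> i) = nu (\<Prod>j\<in>J. v (f j) $ j)"
        using attained by blast
      \<comment> \<open>Otherwise \<open>f\<close> would extend to the larger set \<open>insert k J\<close> with a nonzero weight.\<close>
      let ?f' = "f(k := i)"
      have "(\<Prod>j\<in>J. v (?f' j) $ j) = (\<Prod>j\<in>J. v (f j) $ j)"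
        using k by (intro prod.cong) auto
      then have "(\<Prod>j\<in>insert k J. v (?f' j) $ j) = v i $ k * (\<Prod>j\<in>J. v (f j) $ j)"
        using k by simp
      moreover have "(\<Prod>j\<in>J. v (f j) $ j) \<noteq> 0"
        using f(3) \<open>\<alpha> i \<noteq> 0\<close> by (metis nu_eq_0_iff)
      moreover have "v i $ k \<noteq> 0"
        using nonzero by auto
      ultimately have "(\<Prod>j\<in>insert k J. v (?f' j) $ j) \<noteq> 0"
        by (simp add: mult_nonzero)
      moreover have "inj_on ?f' (insert k J)"
        using f(1,2) k by (auto simp: inj_on_def)
      ultimately have "card (insert k J) \<le> card J"
        using max by blast
      then show False
        using k by simp
    qed
    then show "(\<Sum>i\<in>UNIV. \<alpha> i * v i $ k) \<in> G0"
      by (simp add: zero_in_G0)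
  qed
qed

text \<open>
  The terms of column \<open>k\<close> in the Cramer combination are bounded by the optimal weight, and every
  optimal \<open>\<tau>\<close> attains it in row \<open>\<tau> k\<close>. By the hypothesis \<open>column\<close>, a term of this value has a ghost
  factor or there are two of them.
\<close>

lemma dependent_of_tied_column:
  fixes v :: "'n::finite \<Rightarrow> 'a ^ 'n"
  assumes \<sigma>: "inj \<sigma>" "(\<Prod>j\<in>UNIV. v (\<sigma> j) $ j) \<noteq> 0"
    and optimal: "\<And>\<tau>. inj \<tau> \<Longrightarrow> (\<Prod>j\<in>UNIV. v (\<tau> j) $ j) \<preceq> (\<Prod>j\<in>UNIV. v (\<sigma> j) $ j)"
    and column: "v (\<sigma> k) $ k \<in> G0 \<or>
      (\<exists>\<tau>. inj \<tau> \<and> (\<Prod>j\<in>UNIV. v (\<sigma> j) $ j) \<preceq> (\<Prod>j\<in>UNIV. v (\<tau> j) $ j) \<and> \<tau> k \<noteq> \<sigma> k)"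
  shows "tropically_dependent G0 v"
proof -
  let ?J = "UNIV - {k}"
  let ?W = "\<lambda>f. \<Prod>j\<in>UNIV. v (f j) $ j" and ?w = "\<lambda>f. \<Prod>j\<in>?J. v (f j) $ j"
  have split: "?W f = v (f k) $ k * ?w f" for f
    by (simp add: prod.remove[of UNIV k])
  have "?J \<noteq> UNIV" by blast
  moreover have "inj_on \<sigma> ?J"
    using \<sigma>(1) by (rule inj_on_subset) simp
  moreover have "?w \<sigma> \<noteq> 0"
    using \<sigma>(2) split[of \<sigma>] by auto
  ultimately show ?thesis
  proof (rule dependent_of_partial_matching)
    fix \<alpha> k'
    assume "k' \<notin> ?J"
      and upper: "\<And>f i. inj_on f ?J \<Longrightarrow> i \<notin> f ` ?J \<Longrightarrow> ?w f \<preceq> \<alpha> i"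
      and attained: "\<And>i. \<alpha> i \<noteq> 0 \<Longrightarrow>
        \<exists>f. inj_on f ?J \<and> i \<notin> f ` ?J \<and> nu (\<alpha> i) = nu (?w f)"
    then have k': "k' = k" by simp
    have above: "?W \<tau> \<preceq> \<alpha> (\<tau> k) * v (\<tau> k) $ k" if "inj \<tau>" for \<tau>
    proof -
      have "inj_on \<tau> ?J"
        using that by (rule inj_on_subset) simp
      moreover have "\<tau> k \<notin> \<tau> ` ?J"
        using that by (auto simp: inj_def)
      ultimately have "?w \<tau> \<preceq> \<alpha> (\<tau> k)"
        by (rule upper)
      then have "v (\<tau> k) $ k * ?w \<tau> \<preceq> v (\<tau> k) $ k * \<alpha> (\<tau> k)"
        by (rule nu_le_mult_left)
      then show ?thesis
        by (simp only: split[of \<tau>] mult.commute[of "\<alpha> (\<tau> k)"])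
    qed
    have below: "\<alpha> i * v i $ k \<preceq> ?W \<sigma>" for i
    proof (cases "\<alpha> i = 0")
      case True
      then show ?thesis by (simp add: zero_nu_le)
    next
      case False
      then obtain f where f: "inj_on f ?J" "i \<notin> f ` ?J" "nu (\<alpha> i) = nu (?w f)"
        using attained by blast
      let ?f' = "f(k := i)"
      have "?w ?f' = ?w f"
        by (rule prod.cong) auto
      then have W: "?W ?f' = v i $ k * ?w f"
        unfolding split[of ?f'] by (simp only: fun_upd_same)
      have "nu (\<alpha> i * v i $ k) = nu (?W ?f')"
        unfolding W nu_mult f(3) by (rule mult.commute)
      then have "\<alpha> i * v i $ k \<preceq> ?W ?f'"
        by (rule nu_le_of_nu_eq)
      moreover have "inj_on ?f' (insert k ?J)"
        using f(1,2) by (auto simp: inj_on_def)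
      then have "inj ?f'"
        by (simp only: insert_Diff[OF UNIV_I])
      then have "?W ?f' \<preceq> ?W \<sigma>"
        by (rule optimal)
      ultimately show ?thesis
        by (rule nu_le_trans)
    qed
    have "(\<Sum>i\<in>UNIV. \<alpha> i * v i $ k) \<in> G0"
    proof (rule ccontr)
      assume "(\<Sum>i\<in>UNIV. \<alpha> i * v i $ k) \<notin> G0"
      then obtain i where i: "\<alpha> i * v i $ k \<notin> G0"
        and strict: "\<And>l. \<alpha> i * v i $ k \<preceq> \<alpha> l * v l $ k \<Longrightarrow> l = i"
        using sum_tangible_iff[of UNIV "\<lambda>i. \<alpha> i * v i $ k"] by auto
      have unique: "\<tau> k = i" if "inj \<tau>" "?W \<sigma> \<preceq> ?W \<tau>" for \<tau>
        by (intro strict nu_le_trans[OF below] nu_le_trans[OF that(2)] above that(1))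
      have \<sigma>k: "\<sigma> k = i"
        using \<sigma>(1) nu_le_refl by (rule unique)
      then have "v (\<sigma> k) $ k \<notin> G0"
        using i mult_in_G0 by auto
      then obtain \<tau> where "inj \<tau>" "?W \<sigma> \<preceq> ?W \<tau>" "\<tau> k \<noteq> \<sigma> k"
        using column by auto
      then show False
        using unique[of \<tau>] \<sigma>k by simp
    qed
    then show "(\<Sum>i\<in>UNIV. \<alpha> i * v i $ k') \<in> G0"
      by (simp add: k')
  qed
qed

lemma dependent_if_det_ghost:
  fixes v :: "'n::finite \<Rightarrow> 'a ^ 'n"
  assumes "tropical_det (\<chi> i. v i) \<in> G0"
  shows "tropically_dependent G0 v"
proof -
  let ?W = "\<lambda>f. \<Prod>j\<in>UNIV. v (f j) $ j"
  have ghost: "sum ?W {\<sigma>. inj \<sigma>} \<in> G0"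
    using assms by (simp add: tropical_det_by_columns permutes_UNIV_iff_inj)
  have "{\<sigma> :: 'n \<Rightarrow> 'n. inj \<sigma>} \<noteq> {}"
    using inj_on_id by blast
  from finite_nu_maximum[OF finite this, of ?W]
  obtain \<sigma> where \<sigma>: "inj \<sigma>" and optimal: "\<And>\<tau>. inj \<tau> \<Longrightarrow> ?W \<tau> \<preceq> ?W \<sigma>"
    by auto
  show ?thesis
  proof (cases "?W \<sigma> = 0")
    case True
    have "?W \<tau> = 0" if "inj \<tau>" for \<tau>
      using optimal[OF that] unfolding True by (rule nu_le_zero)
    then show ?thesis
      by (rule dependent_if_all_weights_zero)
  next
    case False
    have "\<exists>k. v (\<sigma> k) $ k \<in> G0 \<or> (\<exists>\<tau>. inj \<tau> \<and> ?W \<sigma> \<preceq> ?W \<tau> \<and> \<tau> k \<noteq> \<sigma> k)"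
    proof (cases "?W \<sigma> \<in> G0")
      case True
      then show ?thesis
        using prod_not_ghost[of UNIV "\<lambda>j. v (\<sigma> j) $ j"] by auto
    next
      case False
      then obtain \<tau> where "inj \<tau>" "\<tau> \<noteq> \<sigma>" "?W \<sigma> \<preceq> ?W \<tau>"
        using ghost \<sigma> sum_tangible_iff[of "{\<sigma>. inj \<sigma>}" ?W] by auto
      then show ?thesis
        by (auto simp: fun_eq_iff)
    qed
    then obtain k where
        "v (\<sigma> k) $ k \<in> G0 \<or> (\<exists>\<tau>. inj \<tau> \<and> ?W \<sigma> \<preceq> ?W \<tau> \<and> \<tau> k \<noteq> \<sigma> k)" ..
    with \<sigma> False optimal show ?thesis
      by (rule dependent_of_tied_column)
  qed
qed

end

theorem theorem6p5:
  fixes G0 :: "'a::comm_semiring_1 set" and nu :: "'a \<Rightarrow> 'a"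
    and v :: "'n::finite \<Rightarrow> 'a ^ 'n"
  assumes "supertropical_domain G0 nu"
  shows "tropically_dependent G0 v \<longleftrightarrow> tropical_det (\<chi> i. v i) \<in> G0"
proof -
  interpret supertropical_domain G0 nu by fact
  show ?thesis
    using det_ghost_if_dependent dependent_if_det_ghost by blast
qed

end
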